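(* For all integers $j\geq 0$ and all integers $n\geq 0$, $$ A\left(9^{j+1}n + \frac{39\cdot 9^j+1}{8}\right) \equiv 0 \pmod{3}. $$
   Context: A cubic partition of a nonnegative integer $n$ is an integer partition of $n$ in which the even parts are allowed to appear in two different colors. For $n \geq 0$, $A(n)$ denotes the difference between the number of cubic partitions of $n$ into an even number of parts and the number of cubic partitions of $n$ into an odd number of parts. Equivalently, $A(n)$ is given by the generating function $$\sum_{n=0}^{\infty} A(n)q^n = (q;q^2)_{\infty}(q^2;q^4)_{\infty} = \frac{(q;q)_\infty}{(q^4;q^4)_\infty},$$ where $(a;q)_\infty = (1-a)(1-aq)(1-aq^2)(1-aq^3)\cdots$. *)

theory Defs
  imports Main "HOL-Library.Multiset" "HOL-Number_Theory.Cong"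
begin

text \<open>
  A coloured part is a pair of its value and its colour. Odd parts only occur in colour
  \<^term>\<open>False\<close>; even parts may occur in either colour, and parts of equal value but
  different colour are different parts.
\<close>

definition cubic_partitions :: "nat \<Rightarrow> (nat \<times> bool) multiset set" where
  "cubic_partitions n =
     {P. (\<forall>(k, c) \<in># P. k > 0 \<and> (odd k \<longrightarrow> c = False)) \<and> (\<Sum>(k, c) \<in># P. k) = n}"

definition A :: "nat \<Rightarrow> int" where
  "A n = int (card {P \<in> cubic_partitions n. even (size P)})
       - int (card {P \<in> cubic_partitions n. odd (size P)})"

text \<open>Finiteness ensures that \<^const>\<open>card\<close> in the definition of \<^const>\<open>A\<close> really counts.\<close>

lemma finite_cubic_partitions: "finite (cubic_partitions n)"
proof -
  have size_le: "size P \<le> (\<Sum>(k, c) \<in># P. k)" if "\<forall>(k, c) \<in># P. 0 < k"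
    for P :: "(nat \<times> bool) multiset"
    using that by (induction P) auto
  have part_le: "k \<le> (\<Sum>(k, c) \<in># P. k)" if "(k, c) \<in># P"
    for P :: "(nat \<times> bool) multiset" and k c
    using that by (induction P) auto
  have "cubic_partitions n \<subseteq> (\<Union>m\<le>n. multisets_of_size ({..n} \<times> UNIV) m)"
  proof
    fix P assume P: "P \<in> cubic_partitions n"
    then have "size P \<le> n"
      using size_le[of P] unfolding cubic_partitions_def by fastforce
    moreover have "set_mset P \<subseteq> {..n} \<times> UNIV"
      using P part_le[of _ _ P] unfolding cubic_partitions_def by auto
    ultimately show "P \<in> (\<Union>m\<le>n. multisets_of_size ({..n} \<times> UNIV) m)"
      unfolding multisets_of_size_def by blast
  qed
  then show ?thesis
    by (rule finite_subset) (auto intro!: finite_multisets_of_size)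
qed

text \<open>The offset in the congruence is an integer, so the truncating division is exact.\<close>

lemma offset_exact: "(8::nat) dvd 39 * 9 ^ j + 1"
proof (induction j)
  case (Suc j)
  have "39 * 9 ^ Suc j + 1 = (39 * 9 ^ j + 1) + 8 * (39 * 9 ^ j :: nat)"
    by simp
  with Suc show ?case
    by (metis dvd_add dvd_triv_left)
qed simp

end

theory Submission
  imports Defs "HOL-Computational_Algebra.Formal_Power_Series"
begin

text \<open>
  With \<open>\<psi>(q) = \<Sum>\<^sub>k\<^sub>\<ge>\<^sub>0 q^(k(k+1)/2)\<close> and \<open>\<phi>(q) = \<Sum>\<^sub>k q^(k\<^sup>2)\<close>, Gauss's product for \<open>\<psi>\<close> gives
  \<open>\<Sum> (-1)\<^sup>n A(n) q\<^sup>n = \<psi>(q) / \<psi>(q\<^sup>2)\<close>, which is congruent to \<open>\<psi>(q) \<psi>(q\<^sup>2)\<^sup>2 / \<psi>(q\<^sup>6)\<close> mod 3.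
  Writing \<open>\<psi>(q) = P(q\<^sup>3) + q \<psi>(q\<^sup>9)\<close>, where \<open>P\<close> runs over the pentagonal numbers, one extracts the
  exponents \<open>3n + 2\<close>; the identities \<open>P(q) P(q\<^sup>2) + 2q \<psi>(q\<^sup>3) \<psi>(q\<^sup>6) = \<psi>(q) \<phi>(q)\<close> and
  \<open>\<psi>(q)\<^sup>2 = \<psi>(q\<^sup>2) \<phi>(q)\<close> turn the result into \<open>-\<psi>(q\<^sup>2) \<psi>(q\<^sup>3)\<close> mod 3. As \<open>\<psi>(q\<^sup>2)\<close> has no exponents
  congruent to 1 mod 3, this settles \<open>A(9n + 5)\<close>; two further trisections reproduce
  \<open>-\<psi>(q\<^sup>2) \<psi>(q\<^sup>3)\<close>, so that \<open>A(27n + 17)\<close> and \<open>A(3n + 2)\<close> agree mod 3 up to sign, which is the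
  induction step.
\<close>


subsection \<open>Formal power series\<close>

lemma nth_compose_X_power:
  fixes f :: "'a::comm_ring_1 fps"
  assumes "k > 0"
  shows "fps_nth (f oo fps_X ^ k) n = (if k dvd n then fps_nth f (n div k) else 0)"
proof -
  have "fps_nth (f oo fps_X ^ k) n = (\<Sum>i=0..n. if n = k * i then fps_nth f i else 0)"
    unfolding fps_compose_nth by (intro sum.cong) (simp_all flip: power_mult)
  also have "\<dots> = (\<Sum>i=0..n. if i = n div k then (if k dvd n then fps_nth f (n div k) else 0) else 0)"
    using assms by (intro sum.cong) auto
  also have "\<dots> = (if k dvd n then fps_nth f (n div k) else 0)"
    by (simp add: div_le_dividend)
  finally show ?thesis .
qed

lemma compose_X_power_mult:
  fixes f g :: "'a::idom fps"
  shows "k > 0 \<Longrightarrow> (f * g) oo fps_X ^ k = (f oo fps_X ^ k) * (g oo fps_X ^ k)"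
  by (simp add: fps_compose_mult_distrib)

lemma compose_X_power_X_power:
  fixes f :: "'a::idom fps"
  assumes "k > 0" "m > 0"
  shows "(f oo fps_X ^ k) oo fps_X ^ m = f oo fps_X ^ (k * m)"
proof -
  have "(f oo fps_X ^ k) oo fps_X ^ m = f oo (fps_X ^ k oo fps_X ^ m)"
    using assms by (simp add: fps_compose_assoc)
  then show ?thesis
    using assms by (simp add: fps_X_power_compose mult.commute flip: power_mult)
qed

section \<open>Divisibility of series by integers and by powers of the variable\<close>

lemma numeral_dvd_fps_iff:
  fixes f :: "int fps"
  shows "numeral k dvd f \<longleftrightarrow> (\<forall>n. numeral k dvd fps_nth f n)"
proof
  assume "numeral k dvd f"
  then obtain g where "f = numeral k * g" ..
  then show "\<forall>n. numeral k dvd fps_nth f n"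
    by (simp add: numeral_fps_const)
next
  assume *: "\<forall>n. numeral k dvd fps_nth f n"
  have "f = numeral k * Abs_fps (\<lambda>n. fps_nth f n div numeral k)"
    using * by (simp add: fps_eq_iff numeral_fps_const)
  then show "numeral k dvd f" ..
qed

text \<open>This replaces convergence: infinite products enter only through finite truncations,
  compared modulo \<open>fps_X ^ n\<close> for every \<open>n\<close>.\<close>

lemma X_power_dvd_iff:
  fixes f :: "'a::comm_ring_1 fps"
  shows "fps_X ^ k dvd f \<longleftrightarrow> (\<forall>n<k. fps_nth f n = 0)"
proof
  assume "fps_X ^ k dvd f"
  then show "\<forall>n<k. fps_nth f n = 0"
    by (auto simp: fps_X_power_mult_nth)
next
  assume "\<forall>n<k. fps_nth f n = 0"
  then have "f = fps_X ^ k * fps_shift k f"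
    by (simp add: fps_eq_iff fps_X_power_mult_nth)
  then show "fps_X ^ k dvd f" ..
qed

lemma fps_dvd_one:
  fixes u :: "'a::comm_ring_1 fps"
  assumes "fps_nth u 0 = 1"
  shows "u dvd 1"
  using fps_right_inverse[of u 1] assms by (metis dvd_triv_left mult_1)

lemma dvd_mult_unit_cancel:
  fixes a u h :: "'a::comm_ring_1"
  assumes "u dvd 1" "a dvd u * h"
  shows "a dvd h"
proof -
  obtain v where "1 = u * v" using assms(1) ..
  then have "h = v * (u * h)" by (simp add: algebra_simps)
  then show ?thesis using assms(2) by (metis dvd_mult)
qed

text \<open>Frobenius modulo 3. With the constant term split off, \<open>f = c + X g\<close>, the
  cube consists of \<open>c ^ 3\<close>, \<open>X^3 g^3\<close> and multiples of 3. Fermat's little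
  theorem settles \<open>c\<close>, and coefficient \<open>n\<close> for \<open>f\<close> reduces to
  coefficient \<open>n - 3\<close> for \<open>g\<close>.\<close>

lemma three_dvd_cube_diff:
  fixes f :: "int fps"
  shows "3 dvd f ^ 3 - (f oo fps_X ^ 3)"
  unfolding numeral_dvd_fps_iff
proof
  fix n
  show "3 dvd fps_nth (f ^ 3 - (f oo fps_X ^ 3)) n"
  proof (induction n arbitrary: f rule: less_induct)
    case (less n)
    define c where "c = fps_nth f 0"
    define g where "g = fps_shift 1 f"
    have f: "f = fps_const c + fps_X * g"
      by (simp add: fps_eq_iff c_def g_def)
    have "f oo fps_X ^ 3 = fps_const c + fps_X ^ 3 * (g oo fps_X ^ 3)"
      unfolding f by (simp add: fps_compose_add_distrib fps_compose_mult_distrib)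
    moreover have "f ^ 3 = fps_const (c ^ 3) + fps_X ^ 3 * g ^ 3
        + 3 * (fps_const c ^ 2 * (fps_X * g) + fps_const c * (fps_X * g) ^ 2)"
      unfolding f by (simp add: power2_eq_square power3_eq_cube algebra_simps flip: fps_const_mult)
    ultimately have eq: "f ^ 3 - (f oo fps_X ^ 3) = fps_const (c ^ 3 - c)
        + fps_X ^ 3 * (g ^ 3 - (g oo fps_X ^ 3))
        + 3 * (fps_const c ^ 2 * (fps_X * g) + fps_const c * (fps_X * g) ^ 2)" (is "_ = ?a + ?b + 3 * ?d")
      by (simp add: algebra_simps flip: fps_const_sub)
    have "3 dvd c ^ 3 - c"
    proof -
      have "c mod 3 = 0 \<or> c mod 3 = 1 \<or> c mod 3 = 2" by auto
      then have "((c mod 3) ^ 3 - c mod 3) mod 3 = 0"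
        by (elim disjE) (simp_all only: , simp_all)
      moreover have "(c ^ 3 - c) mod 3 = (c ^ 3 mod 3 - c mod 3) mod 3"
        by (simp only: mod_diff_eq)
      moreover have "(c ^ 3 mod 3 - c mod 3) mod 3 = ((c mod 3) ^ 3 - c mod 3) mod 3"
        by (simp only: power_mod[of c, symmetric] mod_diff_left_eq)
      ultimately show ?thesis by (simp only: dvd_eq_mod_eq_0)
    qed
    then have "3 dvd fps_nth ?a n" by simp
    moreover have "3 dvd fps_nth ?b n"
      using less.IH[of "n - 3" g] by (auto simp: fps_X_power_mult_nth simp del: fps_sub_nth)
    moreover have "3 dvd fps_nth (3 * ?d) n"
      using numeral_dvd_fps_iff[of "num.Bit1 num.One" "3 * ?d"] by simp
    ultimately show ?case unfolding eq by (simp only: fps_add_nth dvd_add)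
  qed
qed

subsection \<open>Theta series\<close>

text \<open>The formal sum of \<open>q ^ e x\<close> over \<open>I\<close>. As \<open>card\<close>
  is 0 on infinite sets, it has this meaning only when all fibres of \<open>e\<close> are
  finite.\<close>

definition theta :: "('a \<Rightarrow> nat) \<Rightarrow> 'a set \<Rightarrow> int fps" where
  "theta e I = Abs_fps (\<lambda>n. int (card {x \<in> I. e x = n}))"

definition finite_fibres :: "('a \<Rightarrow> nat) \<Rightarrow> 'a set \<Rightarrow> bool" where
  "finite_fibres e I \<longleftrightarrow> (\<forall>n. finite {x \<in> I. e x = n})"

lemma finite_fibres_subset: "finite_fibres e I \<Longrightarrow> J \<subseteq> I \<Longrightarrow> finite_fibres e J"
  unfolding finite_fibres_def by (fast elim: rev_finite_subset)

lemma Times_fibre: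
  "{p \<in> I \<times> J. (case p of (x, y) \<Rightarrow> e x + f y) = (n::nat)}
     = (\<Union>i\<le>n. {x \<in> I. e x = i} \<times> {y \<in> J. f y = n - i})"
  by auto

lemma finite_fibres_Times:
  assumes "finite_fibres e I" "finite_fibres f J"
  shows "finite_fibres (\<lambda>(x, y). e x + f y) (I \<times> J)"
  using assms unfolding finite_fibres_def Times_fibre by auto

lemma theta_mult:
  assumes "finite_fibres e I" "finite_fibres f J"
  shows "theta e I * theta f J = theta (\<lambda>(x, y). e x + f y) (I \<times> J)"
proof (rule fps_ext)
  fix n
  have "card {p \<in> I \<times> J. (case p of (x, y) \<Rightarrow> e x + f y) = n}
     = (\<Sum>i\<le>n. card ({x \<in> I. e x = i} \<times> {y \<in> J. f y = n - i}))"
    unfolding Times_fibre using assms unfolding finite_fibres_def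
    by (intro card_UN_disjoint) auto
  then show "fps_nth (theta e I * theta f J) n = fps_nth (theta (\<lambda>(x, y). e x + f y) (I \<times> J)) n"
    by (simp add: theta_def fps_mult_nth card_cartesian_product atMost_atLeast0)
qed

text \<open>Every dissection and lattice identity below rests on such a change of variables matching
  exponents.\<close>

lemma theta_reindex:
  assumes "bij_betw h J I" "\<And>x. x \<in> J \<Longrightarrow> e (h x) = f x"
  shows "theta e I = theta f J"
proof -
  have "bij_betw h {x \<in> J. f x = n} {x \<in> I. e x = n}" for n
    using assms unfolding bij_betw_def inj_on_def by (auto simp: image_iff) 
  then show ?thesis
    unfolding theta_def by (metis bij_betw_same_card)
qed

lemma theta_Un:
  assumes "finite_fibres e (I \<union> J)" "I \<inter> J = {}"
  shows "theta e (I \<union> J) = theta e I + theta e J"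
proof (rule fps_ext)
  fix n
  have "{x \<in> I \<union> J. e x = n} = {x \<in> I. e x = n} \<union> {x \<in> J. e x = n}" by auto
  moreover have "finite {x \<in> I. e x = n}" "finite {x \<in> J. e x = n}"
    using assms(1) finite_fibres_subset[of e "I \<union> J"] unfolding finite_fibres_def by auto
  moreover have "{x \<in> I. e x = n} \<inter> {x \<in> J. e x = n} = {}"
    using assms(2) by auto
  ultimately show "fps_nth (theta e (I \<union> J)) n = fps_nth (theta e I + theta e J) n"
    by (simp add: theta_def card_Un_disjoint)
qed

lemma theta_shift: "theta (\<lambda>x. k + e x) I = fps_X ^ k * theta e I"
proof (rule fps_ext)
  fix n
  have "{x \<in> I. k + e x = n} = (if n < k then {} else {x \<in> I. e x = n - k})" by auto
  then show "fps_nth (theta (\<lambda>x. k + e x) I) n = fps_nth (fps_X ^ k * theta e I) n"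
    by (simp add: theta_def fps_X_power_mult_nth)
qed

lemma theta_scale:
  assumes "k > 0"
  shows "theta (\<lambda>x. k * e x) I = theta e I oo fps_X ^ k"
proof (rule fps_ext)
  fix n
  have "{x \<in> I. k * e x = n} = (if k dvd n then {x \<in> I. e x = n div k} else {})"
    using assms by auto
  then show "fps_nth (theta (\<lambda>x. k * e x) I) n = fps_nth (theta e I oo fps_X ^ k) n"
    using assms by (simp add: theta_def nth_compose_X_power)
qed

lemma theta_finite:
  assumes "finite I"
  shows "theta e I = (\<Sum>x\<in>I. fps_X ^ e x)"
proof (rule fps_ext)
  fix n
  have "fps_nth (\<Sum>x\<in>I. fps_X ^ e x :: int fps) n = (\<Sum>x\<in>I. if e x = n then 1 else 0)"
    unfolding fps_sum_nth by (intro sum.cong) auto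
  also have "\<dots> = int (card {x \<in> I. e x = n})"
    using assms by (simp add: sum.If_cases Int_def)
  finally show "fps_nth (theta e I) n = fps_nth (\<Sum>x\<in>I. fps_X ^ e x) n"
    by (simp add: theta_def)
qed

lemma X_power_dvd_theta:
  assumes "\<And>x. x \<in> I \<Longrightarrow> k \<le> e x"
  shows "fps_X ^ k dvd theta e I"
proof -
  have "card {x \<in> I. e x = n} = 0" if "n < k" for n
    using assms that by (force intro: card_eq_0_iff[THEN iffD2])
  then show ?thesis by (simp add: X_power_dvd_iff theta_def)
qed

section \<open>Triangular, pentagonal and square exponents\<close>

definition tri :: "int \<Rightarrow> nat" where "tri k = nat (k * (k + 1) div 2)"
definition pent :: "int \<Rightarrow> nat" where "pent k = nat (k * (3 * k + 1) div 2)"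
definition sq :: "int \<Rightarrow> nat" where "sq k = nat (k ^ 2)"

lemma int_mult_Suc_nonneg: "0 \<le> k * (k + 1)" for k :: int
  by (cases "k \<ge> 0") (auto intro: mult_nonneg_nonneg mult_nonpos_nonpos)

text \<open>The doubled form removes both \<open>div\<close> and \<open>nat\<close>, so that
  exponent identities become polynomial identities over the integers.\<close>

lemma int_tri: "2 * int (tri k) = k * (k + 1)"
  using int_mult_Suc_nonneg[of k] by (simp add: tri_def)

lemma int_pent: "2 * int (pent k) = k * (3 * k + 1)"
proof -
  have "k * (3 * k + 1) = 2 * k^2 + k * (k + 1)"
    by (simp add: algebra_simps power2_eq_square)
  then have "0 \<le> k * (3 * k + 1)"
    using int_mult_Suc_nonneg[of k] by simp
  then show ?thesis by (simp add: pent_def)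
qed

lemma int_sq: "int (sq k) = k ^ 2"
  by (simp add: sq_def)

lemma abs_le_sq: "\<bar>k\<bar> \<le> k ^ 2" for k :: int
proof (cases "k = 0")
  case False
  then have "\<bar>k\<bar> * 1 \<le> \<bar>k\<bar> * \<bar>k\<bar>" by (intro mult_left_mono) auto
  then show ?thesis by (simp add: power2_eq_square)
qed simp

lemma finite_fibresI:
  fixes e :: "int \<Rightarrow> nat"
  assumes "\<And>k. \<bar>k\<bar> \<le> a * int (e k) + b"
  shows "finite_fibres e I"
  unfolding finite_fibres_def
proof
  fix n
  have "{k \<in> I. e k = n} \<subseteq> {-(a * int n + b)..a * int n + b}"
  proof
    fix k assume "k \<in> {k \<in> I. e k = n}"
    then have "\<bar>k\<bar> \<le> a * int n + b" using assms[of k] by simp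
    then show "k \<in> {-(a * int n + b)..a * int n + b}" by (simp add: abs_le_iff)
  qed
  then show "finite {k \<in> I. e k = n}" by (rule finite_subset) simp
qed

lemma finite_fibres_sq: "finite_fibres sq I"
  by (rule finite_fibresI[of 1 _ 0]) (simp add: int_sq abs_le_sq)

lemma finite_fibres_tri: "finite_fibres tri I"
proof (rule finite_fibresI[of 1 _ 1])
  fix k :: int
  \<comment> \<open>No integer lies strictly between 1 and 2. The resulting bound on
    \<open>3 |k|\<close> is combined with \<open>2 tri k \<ge> k^2 - |k|\<close>.\<close>
  have "0 \<le> (\<bar>k\<bar> - 1) * (\<bar>k\<bar> - 2)"
    by (cases "\<bar>k\<bar> \<ge> 2"; cases "k = 0") (auto intro: mult_nonneg_nonneg mult_nonpos_nonpos)
  then have "3 * \<bar>k\<bar> \<le> k ^ 2 + 2"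
    by (simp add: algebra_simps power2_eq_square)
  then show "\<bar>k\<bar> \<le> 1 * int (tri k) + 1"
    using int_tri[of k] by (simp add: algebra_simps power2_eq_square)
qed

lemma finite_fibres_pent: "finite_fibres pent I"
proof (rule finite_fibresI[of 1 _ 0])
  fix k :: int
  show "\<bar>k\<bar> \<le> 1 * int (pent k) + 0"
    using int_pent[of k] abs_le_sq[of k] by (simp add: algebra_simps power2_eq_square)
qed

lemma finite_fibres_mult: "finite_fibres e I \<Longrightarrow> k > 0 \<Longrightarrow> finite_fibres (\<lambda>x. k * e x) I"
  unfolding finite_fibres_def
proof
  fix n
  assume *: "\<forall>n. finite {x \<in> I. e x = n}" "k > 0"
  have "{x \<in> I. k * e x = n} \<subseteq> {x \<in> I. e x = n div k}" using * by auto
  then show "finite {x \<in> I. k * e x = n}" using * finite_subset by blast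
qed

section \<open>The theta series and their identities\<close>

definition psi :: "int fps" where "psi = theta tri {0..}"
definition phi :: "int fps" where "phi = theta sq UNIV"
definition pentagonal :: "int fps" where "pentagonal = theta pent UNIV"

text \<open>The reflection \<open>k \<mapsto> -1 - k\<close> fixes \<open>tri\<close> and swaps the
  two half-lines. Identities are proved over all integers, where changes of variables are linear,
  and the powers of 2 are cancelled at the end.\<close>

lemma theta_tri: "theta tri UNIV = 2 * psi"
proof -
  have "theta tri UNIV = theta tri ({0..} \<union> {..<0})"
    by (rule arg_cong[of _ _ "theta tri"]) auto
  also have "\<dots> = psi + theta tri {..<0}"
    unfolding psi_def by (rule theta_Un) (auto intro: finite_fibres_tri)
  also have "theta tri {..<0} = psi"
    unfolding psi_def
  proof (rule theta_reindex)
    show "bij_betw (\<lambda>k. - 1 - k) {0::int..} {..<0}"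
      by (rule bij_betwI[of _ _ _ "\<lambda>k. - 1 - k"]) auto
    show "tri (- 1 - k) = tri k" for k
      unfolding tri_def by (rule arg_cong) (simp add: algebra_simps)
  qed
  finally show ?thesis by simp
qed

lemma psi_nth_0: "fps_nth psi 0 = 1"
proof -
  have "{k \<in> {0..}. tri k = 0} = {0}"
  proof (intro set_eqI iffI)
    fix k assume "k \<in> {k \<in> {0..}. tri k = 0}"
    then show "k \<in> {0}" using int_tri[of k] by auto
  qed (simp add: tri_def)
  then show ?thesis by (simp add: psi_def theta_def)
qed

text \<open>The index is split by its residue mod 3: the classes of 0 and -1 both give three times
  the pentagonal exponents, the class of 1 gives \<open>1 + 9 * tri m\<close>.\<close>

lemma psi_dissection:
  "psi = (pentagonal oo fps_X ^ 3) + fps_X * (psi oo fps_X ^ 9)"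
proof -
  define C where "C r = range (\<lambda>m. 3 * m + r)" for r :: int
  have bij: "bij_betw (\<lambda>m. 3 * m + r) UNIV (C r)" for r
    unfolding C_def by (simp add: bij_betw_def inj_def)
  have C: "C r = {k. k mod 3 = r mod 3}" for r
  proof (intro set_eqI iffI)
    fix k assume "k \<in> {k. k mod 3 = r mod 3}"
    then have "k = 3 * ((k - r) div 3) + r" 
      by (simp add: mod_eq_dvd_iff)
    then show "k \<in> C r" unfolding C_def by blast
  qed (auto simp: C_def)
  have "UNIV = (C 0 \<union> C 1) \<union> C (-1)"
    unfolding C by auto
  then have "theta tri UNIV = theta tri ((C 0 \<union> C 1) \<union> C (-1))" by simp
  also have "\<dots> = theta tri (C 0) + theta tri (C 1) + theta tri (C (-1))"
    by (subst theta_Un, rule finite_fibres_tri, force simp: C)+ simp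
  also have "theta tri (C 0) = theta (\<lambda>m. 3 * pent m) UNIV"
  proof (rule theta_reindex[OF bij])
    show "tri (3 * m + 0) = 3 * pent m" for m
      using int_tri[of "3 * m + 0"] int_pent[of m] by (simp add: algebra_simps)
  qed
  also have "theta tri (C 1) = theta (\<lambda>m. 1 + 9 * tri m) UNIV"
  proof (rule theta_reindex[OF bij])
    show "tri (3 * m + 1) = 1 + 9 * tri m" for m
      using int_tri[of "3 * m + 1"] int_tri[of m] by (simp add: algebra_simps)
  qed
  also have "theta tri (C (-1)) = theta (\<lambda>m. 3 * pent m) UNIV"
  proof (rule theta_reindex)
    \<comment> \<open>The sign of \<open>m\<close> is reversed because \<open>3m(3m - 1)/2\<close>
      is \<open>3 * pent (- m)\<close>.\<close>
    show "bij_betw (\<lambda>m. 3 * (- m) + (-1)) UNIV (C (-1))"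
      using bij_betw_trans[OF bij_uminus bij[of "-1"]] by (simp add: o_def)
    show "tri (3 * (- m) + (-1)) = 3 * pent m" for m
      using int_tri[of "3 * (- m) + (-1)"] int_pent[of m] by (simp add: algebra_simps)
  qed
  also have "theta (\<lambda>m. 1 + 9 * tri m) UNIV = fps_X * (theta tri UNIV oo fps_X ^ 9)"
    using theta_shift[of 1 "\<lambda>m. 9 * tri m" UNIV] by (simp add: theta_scale)
  also have "theta (\<lambda>m. 3 * pent m) UNIV = pentagonal oo fps_X ^ 3"
    by (simp add: theta_scale pentagonal_def)
  finally have "2 * psi = 2 * (pentagonal oo fps_X ^ 3) + fps_X * (2 * psi oo fps_X ^ 9)"
    by (simp add: theta_tri)
  also have "2 * psi oo fps_X ^ 9 = 2 * (psi oo fps_X ^ 9)"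
    by (simp only: mult_2 fps_compose_add_distrib)
  finally have "2 * psi = 2 * ((pentagonal oo fps_X ^ 3) + fps_X * (psi oo fps_X ^ 9))"
    by (simp add: algebra_simps)
  then show ?thesis by (metis mult_cancel_left zero_neq_numeral)
qed

text \<open>The lattice of pairs \<open>(x, y)\<close> is split by the parity of \<open>x + y\<close>.\<close>

lemma psi_squared: "psi ^ 2 = (psi oo fps_X ^ 2) * phi"
proof -
  define e where "e = (\<lambda>(x, y). tri x + tri y)"
  define f where "f = (\<lambda>(u, v). 2 * tri u + sq v)"
  define D where "D = {(x::int, y::int). even (x + y)}"
  have fin: "finite_fibres e I" for I
    using finite_fibres_subset[OF finite_fibres_Times[OF finite_fibres_tri[of UNIV] finite_fibres_tri[of UNIV]]]
    unfolding e_def by simp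
  have "theta tri UNIV * theta tri UNIV = theta e (D \<union> - D)"
    by (simp add: theta_mult finite_fibres_tri e_def)
  also have "\<dots> = theta e D + theta e (- D)"
    by (rule theta_Un) (auto intro: fin)
  also have "theta e D = theta f UNIV"
  proof (rule theta_reindex)
    show "bij_betw (\<lambda>(u, v). (u + v, u - v)) UNIV D"
      by (rule bij_betwI[of _ _ _ "\<lambda>(x, y). ((x + y) div 2, (x - y) div 2)"])
        (simp_all add: D_def split: prod.splits del: even_add, (clarify; presburger)+)
    show "e (case x of (u, v) \<Rightarrow> (u + v, u - v)) = f x" for x
    proof (cases x)
      case (Pair u v)
      then show ?thesis
        using int_tri[of "u + v"] int_tri[of "u - v"] int_tri[of u] int_sq[of v]
        by (simp add: e_def f_def algebra_simps power2_eq_square)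
    qed
  qed
  also have "theta e (- D) = theta f UNIV"
  proof (rule theta_reindex)
    \<comment> \<open>The reflection \<open>y \<mapsto> -1 - y\<close> preserves
      \<open>tri y\<close> and exchanges the two parity classes; this map is the previous one
      followed by it.\<close>
    show "bij_betw (\<lambda>(u, v). (u + v, v - u - 1)) UNIV (- D)"
      by (rule bij_betwI[of _ _ _ "\<lambda>(x, y). ((x - y) div 2, (x + y + 1) div 2)"])
        (simp_all add: D_def split: prod.splits del: even_add, (clarify; presburger)+)
    show "e (case x of (u, v) \<Rightarrow> (u + v, v - u - 1)) = f x" for x
    proof (cases x)
      case (Pair u v)
      then show ?thesis
        using int_tri[of "u + v"] int_tri[of "v - u - 1"] int_tri[of u] int_sq[of v]
        by (simp add: e_def f_def algebra_simps power2_eq_square)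
    qed
  qed
  also have "theta f UNIV = (theta tri UNIV oo fps_X ^ 2) * phi"
    unfolding f_def phi_def
    by (simp add: theta_mult finite_fibres_tri finite_fibres_sq finite_fibres_mult flip: theta_scale)
  also have "theta tri UNIV oo fps_X ^ 2 = 2 * (psi oo fps_X ^ 2)"
    unfolding theta_tri by (simp only: mult_2 fps_compose_add_distrib)
  finally have "4 * psi ^ 2 = 4 * ((psi oo fps_X ^ 2) * phi)"
    by (simp add: theta_tri power2_eq_square)
  then show ?thesis by (metis mult_cancel_left zero_neq_numeral)
qed

text \<open>
  Multiplication by \<open>1 + \<surd>-2\<close>, of norm 3, maps the form \<open>c\<^sup>2 + 2d\<^sup>2\<close> underlying \<open>psi * phi\<close> into the form
  \<open>a\<^sup>2 + 2b\<^sup>2\<close> underlying \<open>psi(q) psi(q\<^sup>2)\<close>. For \<open>c = 2i + 1\<close>, \<open>d = 2k\<close> one gets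
  \<open>b = 2(i + k) + 1\<close>; the classes below are the residues of \<open>i + k\<close> mod 3.
\<close>

lemma psi_phi_lattice:
  "pentagonal * (pentagonal oo fps_X ^ 2) + 2 * (fps_X * (psi oo fps_X ^ 3) * (psi oo fps_X ^ 6))
     = psi * phi"
proof -
  define e where "e = (\<lambda>(i, k). tri i + sq k)"
  define f where "f = (\<lambda>(m, n). pent m + 2 * pent n)"
  define g where "g = (\<lambda>(m, n). 3 * tri m + 6 * tri n)"
  have T: "theta tri UNIV oo fps_X ^ k = 2 * (psi oo fps_X ^ k)" for k
    unfolding theta_tri by (simp only: mult_2 fps_compose_add_distrib)
  define C where "C r = {(i::int, k::int). (i + k) mod 3 = r}" for r
  have fin: "finite_fibres e I" for I
    using finite_fibres_subset[OF finite_fibres_Times[OF finite_fibres_tri[of UNIV] finite_fibres_sq[of UNIV]]]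
    unfolding e_def by simp
  have "UNIV = (C 0 \<union> C 1) \<union> C 2"
    unfolding C_def by auto
  then have "theta tri UNIV * phi = theta e ((C 0 \<union> C 1) \<union> C 2)"
    by (simp add: phi_def theta_mult finite_fibres_tri finite_fibres_sq e_def)
  also have "\<dots> = theta e (C 0) + theta e (C 1) + theta e (C 2)"
    by (subst theta_Un, rule fin, force simp: C_def)+ simp
  also have "theta e (C 0) = theta f UNIV"
  proof (rule theta_reindex)
    show "bij_betw (\<lambda>(m, n). (m + 2 * n, n - m)) UNIV (C 0)"
      by (rule bij_betwI[of _ _ _ "\<lambda>(i, k). ((i + k) div 3 - k, (i + k) div 3)"])
        (auto simp: C_def)
    show "e (case x of (m, n) \<Rightarrow> (m + 2 * n, n - m)) = f x" for x
    proof (cases x)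
      case (Pair m n)
      then show ?thesis
        using int_tri[of "m + 2 * n"] int_sq[of "n - m"] int_pent[of m] int_pent[of n]
        by (simp add: e_def f_def algebra_simps power2_eq_square)
    qed
  qed
  also have "theta e (C 1) = theta (\<lambda>x. 1 + g x) UNIV"
  proof (rule theta_reindex)
    show "bij_betw (\<lambda>(m, n). (m + 2 * n + 1, n - m)) UNIV (C 1)"
      by (rule bij_betwI[of _ _ _ "\<lambda>(i, k). ((i + k) div 3 - k, (i + k) div 3)"])
        (auto simp: C_def, presburger+)
    show "e (case x of (m, n) \<Rightarrow> (m + 2 * n + 1, n - m)) = 1 + g x" for x
    proof (cases x)
      case (Pair m n)
      then show ?thesis
        using int_tri[of "m + 2 * n + 1"] int_sq[of "n - m"] int_tri[of m] int_tri[of n]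
        by (simp add: e_def g_def algebra_simps power2_eq_square)
    qed
  qed
  also have "theta e (C 2) = theta f UNIV"
  proof (rule theta_reindex)
    \<comment> \<open>The reflection \<open>(i, k) \<mapsto> (-1 - i, -k)\<close> preserves
      \<open>e\<close> and exchanges the classes 0 and 2; this map is the parametrisation of class 0
      followed by it.\<close>
    show "bij_betw (\<lambda>(m, n). (- m - 2 * n - 1, m - n)) UNIV (C 2)"
      by (rule bij_betwI[of _ _ _ "\<lambda>(i, k). (k - (i + k + 1) div 3, - ((i + k + 1) div 3))"])
        (auto simp: C_def, presburger+)
    show "e (case x of (m, n) \<Rightarrow> (- m - 2 * n - 1, m - n)) = f x" for x
    proof (cases x)
      case (Pair m n)
      then show ?thesis
        using int_tri[of "- m - 2 * n - 1"] int_sq[of "m - n"] int_pent[of m] int_pent[of n]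
        by (simp add: e_def f_def algebra_simps power2_eq_square)
    qed
  qed
  also have "theta (\<lambda>x. 1 + g x) UNIV = fps_X * theta g UNIV"
    using theta_shift[of 1 g UNIV] by simp
  also have "theta g UNIV = (theta tri UNIV oo fps_X ^ 3) * (theta tri UNIV oo fps_X ^ 6)"
    unfolding g_def
    by (simp add: theta_mult finite_fibres_tri finite_fibres_mult flip: theta_scale)
  also have "theta f UNIV = pentagonal * (pentagonal oo fps_X ^ 2)"
    unfolding f_def pentagonal_def
    by (simp add: theta_mult finite_fibres_pent finite_fibres_mult flip: theta_scale)
  finally have "2 * (pentagonal * (pentagonal oo fps_X ^ 2)
      + 2 * (fps_X * (psi oo fps_X ^ 3) * (psi oo fps_X ^ 6))) = 2 * (psi * phi)"
    by (simp add: T) (simp add: theta_tri algebra_simps)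
  then show ?thesis by (metis mult_cancel_left zero_neq_numeral)
qed



subsection \<open>Gauss's product for the triangular theta series\<close>

text \<open>A finite form of Gauss's identity, proved by telescoping. On the right, the term
  \<open>s = 0\<close> is the product over even exponents, and every other term carries a power of
  \<open>x\<close> beyond \<open>2 * n\<close>.\<close>

lemma Shanks_identity:
  fixes x :: "'a::comm_ring_1"
  shows "(\<Prod>j<n. 1 - x ^ (2 * j + 1)) * (\<Sum>s<2 * n. x ^ (s * (s + 1) div 2))
    = (\<Sum>s<n. (\<Prod>j=s..<n. 1 - x ^ (2 * j + 2)) * (\<Prod>j<s. 1 - x ^ (2 * j + 1)) * x ^ (s * (2 * n + 1)))"
proof (induction n)
  case (Suc n)
  define Q where "Q m = (\<Prod>j<m. 1 - x ^ (2 * j + 1))" for m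
  define c where "c m s = (\<Prod>j=s..<m. 1 - x ^ (2 * j + 2)) * Q s" for m s
  define d where "d s = c n s * (1 - x ^ (2 * s)) * x ^ (s * (2 * n + 1))" for s
  define T where "T = (\<Sum>s<2 * n. x ^ (s * (s + 1) div 2))"
  have IH: "Q n * T = (\<Sum>s<n. c n s * x ^ (s * (2 * n + 1)))"
    using Suc.IH by (simp add: Q_def T_def c_def)
  \<comment> \<open>Up to a factor, the passage from \<open>n\<close> to \<open>n + 1\<close> changes the summand by a difference of \<open>d\<close>.\<close>
  have d_Suc: "d (Suc s) = c n s * (1 - x ^ (2 * s + 1)) * x ^ (Suc s * (2 * n + 1))" if "s < n" for s
    using that by (simp add: d_def c_def Q_def prod.atLeast_Suc_lessThan[of s n] mult_ac)
  have "c (Suc n) s * x ^ (s * (2 * Suc n + 1))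
      = (1 - x ^ (2 * n + 1)) * (c n s * x ^ (s * (2 * n + 1))) + (d (Suc s) - d s)" if "s < n" for s
  proof -
    have "c (Suc n) s = c n s * (1 - x ^ (2 * n + 2))"
      using that by (simp add: c_def mult_ac)
    moreover have "x ^ (s * (2 * Suc n + 1)) = x ^ (s * (2 * n + 1)) * x ^ (2 * s)"
      by (simp add: algebra_simps flip: power_add)
    moreover have "x ^ (Suc s * (2 * n + 1)) = x ^ (s * (2 * n + 1)) * x ^ (2 * n + 1)"
      by (simp add: algebra_simps flip: power_add)
    moreover have "x ^ (2 * s + 1) = x ^ (2 * s) * x" "x ^ (2 * n + 2) = x ^ (2 * n + 1) * x"
      by (simp_all add: mult_ac)
    ultimately show ?thesis
      unfolding d_Suc[OF that] unfolding d_def by (simp only:) (simp add: algebra_simps)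
  qed
  then have "(\<Sum>s<n. c (Suc n) s * x ^ (s * (2 * Suc n + 1)))
      = (1 - x ^ (2 * n + 1)) * (Q n * T) + (d n - d 0)"
    unfolding IH sum_distrib_left sum_lessThan_telescope[symmetric] sum.distrib[symmetric]
    by (intro sum.cong) auto
  moreover have "c (Suc n) n = (1 - x ^ (2 * n + 2)) * Q n" "c n n = Q n"
    by (simp_all add: c_def)
  moreover have "d 0 = 0" by (simp add: d_def)
  ultimately have "(\<Sum>s<Suc n. c (Suc n) s * x ^ (s * (2 * Suc n + 1)))
      = (1 - x ^ (2 * n + 1)) * (Q n * T) + Q n * (1 - x ^ (2 * n)) * x ^ (n * (2 * n + 1))
        + (1 - x ^ (2 * n + 2)) * Q n * x ^ (n * (2 * Suc n + 1))"
    by (simp add: d_def)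
  also have "x ^ (n * (2 * Suc n + 1)) = x ^ (n * (2 * n + 1)) * x ^ (2 * n)"
    by (simp add: algebra_simps flip: power_add)
  \<comment> \<open>The boundary term \<open>d n\<close> and the new summand \<open>s = n\<close>
    combine to \<open>Q n * x ^ (n * (2 * n + 1)) * (1 - x ^ (4 * n + 2))\<close>. Factoring the
    difference of squares leaves exactly the next two triangular powers.\<close>
  also have "(1 - x ^ (2 * n + 1)) * (Q n * T) + Q n * (1 - x ^ (2 * n)) * x ^ (n * (2 * n + 1))
        + (1 - x ^ (2 * n + 2)) * Q n * (x ^ (n * (2 * n + 1)) * x ^ (2 * n))
      = Q n * (1 - x ^ (2 * n + 1)) * (T + x ^ (n * (2 * n + 1)) + x ^ (n * (2 * n + 1)) * x ^ (2 * n + 1))"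
  proof -
    have "x ^ (2 * n + 2) = x ^ (2 * n) * x * x" "x ^ (2 * n + 1) = x ^ (2 * n) * x"
      by (simp_all add: mult_ac)
    then show ?thesis by (simp only:) (simp add: algebra_simps)
  qed
  also have "Q n * (1 - x ^ (2 * n + 1)) = Q (Suc n)"
    by (simp add: Q_def)
  also have "T + x ^ (n * (2 * n + 1)) + x ^ (n * (2 * n + 1)) * x ^ (2 * n + 1)
      = (\<Sum>s<2 * Suc n. x ^ (s * (s + 1) div 2))"
  proof -
    have "2 * n * (2 * n + 1) div 2 = n * (2 * n + 1)"
      "(2 * n + 1) * (2 * n + 1 + 1) div 2 = n * (2 * n + 1) + (2 * n + 1)"
      by (simp_all add: algebra_simps)
    then have "T + x ^ (n * (2 * n + 1)) + x ^ (n * (2 * n + 1)) * x ^ (2 * n + 1)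
        = T + x ^ (2 * n * (2 * n + 1) div 2) + x ^ ((2 * n + 1) * (2 * n + 1 + 1) div 2)"
      by (simp only: power_add)
    also have "\<dots> = (\<Sum>s<Suc (Suc (2 * n)). x ^ (s * (s + 1) div 2))"
      unfolding T_def sum.lessThan_Suc by (simp only: Suc_eq_plus1)
    finally show ?thesis by simp
  qed
  finally show ?case by (simp only: Q_def c_def)
qed simp

section \<open>Truncated products of Gauss and Euler\<close>

definition odd_prod :: "nat \<Rightarrow> int fps" where
  "odd_prod n = (\<Prod>j<n. 1 - fps_X ^ (2 * j + 1))"
definition even_prod :: "nat \<Rightarrow> int fps" where
  "even_prod n = (\<Prod>j<n. 1 - fps_X ^ (2 * j + 2))"
definition plus_prod :: "nat \<Rightarrow> int fps" where
  "plus_prod n = (\<Prod>j<n. 1 + fps_X ^ (j + 1))"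

text \<open>Gauss's product up to order \<open>n\<close>: modulo \<open>fps_X ^ n\<close>, the tail
  of \<open>psi\<close> beyond the \<open>2 * n\<close> terms of Shanks's identity vanishes, and so
  do the summands with \<open>s \<ge> 1\<close>.\<close>

lemma psi_odd_prod: "fps_X ^ n dvd odd_prod n * psi - even_prod n"
proof (cases "n = 0")
  case False
  have tri_nat: "tri (int s) = s * (s + 1) div 2" for s
    by (simp add: tri_def nat_div_distrib nat_mult_distrib nat_add_distrib add.commute)
  have "n \<le> tri k" if "2 * int n \<le> k" for k
  proof -
    have "2 * int n * 1 \<le> k * (k + 1)"
      using that by (intro mult_mono) auto
    then show ?thesis using int_tri[of k] by simp
  qed
  then obtain r where r: "theta tri {2 * int n..} = fps_X ^ n * r"
    using X_power_dvd_theta[of "{2 * int n..}" n tri] by (auto elim: dvdE)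
  have "psi = theta tri ({0..<2 * int n} \<union> {2 * int n..})"
    unfolding psi_def by (rule arg_cong[of _ _ "theta tri"]) auto
  also have "\<dots> = theta tri {0..<2 * int n} + theta tri {2 * int n..}"
    by (rule theta_Un) (auto intro: finite_fibres_tri)
  also have "theta tri {0..<2 * int n} = (\<Sum>s<2 * n. fps_X ^ (s * (s + 1) div 2))"
  proof -
    have "int ` {..<2 * n} = {0..<2 * int n}"
      using image_int_atLeastLessThan[of 0 "2 * n"] by (simp add: lessThan_atLeast0)
    then have "theta tri {0..<2 * int n} = (\<Sum>k\<in>int ` {..<2 * n}. fps_X ^ tri k)"
      by (simp add: theta_finite)
    then show ?thesis by (simp add: sum.reindex o_def tri_nat)
  qed
  finally have psi: "psi = (\<Sum>s<2 * n. fps_X ^ (s * (s + 1) div 2)) + fps_X ^ n * r"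
    by (simp only: r)
  define c :: "nat \<Rightarrow> int fps" where
    "c s = (\<Prod>j=s..<n. 1 - fps_X ^ (2 * j + 2)) * (\<Prod>j<s. 1 - fps_X ^ (2 * j + 1))" for s
  have "odd_prod n * (\<Sum>s<2 * n. fps_X ^ (s * (s + 1) div 2)) = (\<Sum>s<n. c s * fps_X ^ (s * (2 * n + 1)))"
    unfolding odd_prod_def c_def by (rule Shanks_identity)
  also have "{..<n} = insert 0 {1..<n}" using False by auto
  also have "(\<Sum>s\<in>insert 0 {1..<n}. c s * fps_X ^ (s * (2 * n + 1)))
      = even_prod n + (\<Sum>s=1..<n. c s * fps_X ^ (s * (2 * n + 1)))"
    by (simp add: c_def even_prod_def lessThan_atLeast0)
  finally have "odd_prod n * psi - even_prod n
      = (\<Sum>s=1..<n. c s * fps_X ^ (s * (2 * n + 1))) + odd_prod n * (fps_X ^ n * r)"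
    unfolding psi by (simp add: algebra_simps)
  moreover have "fps_X ^ n dvd (\<Sum>s=1..<n. c s * fps_X ^ (s * (2 * n + 1)))"
  proof (intro dvd_sum dvd_mult le_imp_power_dvd)
    fix s assume "s \<in> {1..<n}"
    then have "1 * n \<le> s * (2 * n + 1)" by (intro mult_le_mono) auto
    then show "n \<le> s * (2 * n + 1)" by simp
  qed
  ultimately show ?thesis by (simp add: dvd_add)
qed simp

lemma dvd_prod_minus_one:
  fixes f :: "'b \<Rightarrow> 'a::comm_ring_1"
  assumes "\<And>j. j \<in> S \<Longrightarrow> a dvd f j - 1"
  shows "a dvd prod f S - 1"
  using assms
proof (induction S rule: infinite_finite_induct)
  case (insert x S)
  have "prod f (insert x S) - 1 = f x * (prod f S - 1) + (f x - 1)"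
    using insert.hyps by (simp add: algebra_simps)
  moreover have "a dvd f x * (prod f S - 1) + (f x - 1)"
    using insert by (intro dvd_add dvd_mult) auto
  ultimately show ?case by (simp only:)
qed simp_all

text \<open>Euler's theorem on odd and distinct parts. The product of all \<open>1 - q^i\<close> up
  to \<open>2 * n\<close> is both odd part times even part and \<open>Q\<close> times a tail; the
  even part is \<open>Q * plus_prod n\<close>. Cancelling \<open>Q\<close> leaves the tail, whose
  factors are 1 modulo \<open>fps_X ^ n\<close>.\<close>

lemma odd_prod_plus_prod: "fps_X ^ n dvd odd_prod n * plus_prod n - 1"
proof -
  define Q :: "int fps" where "Q = (\<Prod>j<n. 1 - fps_X ^ (j + 1))"
  have "1 - fps_X ^ (j + 1) \<noteq> (0 :: int fps)" for j
    by (rule fps_nonzeroI[of _ 0]) simp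
  then have "Q \<noteq> 0" by (simp add: Q_def)
  have "(\<Prod>j<2 * n. 1 - fps_X ^ (j + 1)) = odd_prod n * even_prod n"
    unfolding odd_prod_def even_prod_def by (induction n) (simp_all add: mult_ac)
  moreover have "even_prod n = Q * plus_prod n"
    unfolding Q_def even_prod_def plus_prod_def prod.distrib[symmetric]
  proof (rule prod.cong)
    fix j
    have "fps_X ^ (2 * j + 2) = fps_X ^ (j + 1) * (fps_X ^ (j + 1) :: int fps)"
      by (simp flip: power_add add: mult_2)
    moreover have "1 - a * a = (1 - a) * (1 + a)" for a :: "int fps"
      by (simp add: algebra_simps)
    ultimately show "1 - fps_X ^ (2 * j + 2) = (1 - fps_X ^ (j + 1)) * (1 + fps_X ^ (j + 1) :: int fps)"
      by (simp only:)
  qed simp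
  moreover have "(\<Prod>j<2 * n. 1 - fps_X ^ (j + 1)) = Q * (\<Prod>j=n..<2 * n. 1 - fps_X ^ (j + 1))"
    unfolding Q_def lessThan_atLeast0 by (subst prod.atLeastLessThan_concat) simp_all
  ultimately have "Q * (odd_prod n * plus_prod n) = Q * (\<Prod>j=n..<2 * n. 1 - fps_X ^ (j + 1))"
    by (simp add: mult_ac)
  then have "odd_prod n * plus_prod n = (\<Prod>j=n..<2 * n. 1 - fps_X ^ (j + 1))"
    using \<open>Q \<noteq> 0\<close> by simp
  moreover have "fps_X ^ n dvd (\<Prod>j=n..<2 * n. 1 - fps_X ^ (j + 1)) - (1 :: int fps)"
  proof (rule dvd_prod_minus_one)
    fix j assume "j \<in> {n..<2 * n}"
    then have "fps_X ^ n dvd (fps_X ^ (j + 1) :: int fps)"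
      by (intro le_imp_power_dvd) auto
    then show "fps_X ^ n dvd 1 - fps_X ^ (j + 1) - (1 :: int fps)" by simp
  qed
  ultimately show ?thesis by simp
qed

text \<open>Gauss and Euler give \<open>psi\<close> as \<open>even_prod n * plus_prod n\<close> to
  order \<open>n\<close>. After \<open>q \<mapsto> q^2\<close>, the factors
  \<open>1 - q^(4i)\<close> split as \<open>(1 - q^(2i)) (1 + q^(2i))\<close>, producing the same
  squared factor as in the count of cubic partitions.\<close>

lemma psi_square_prod:
  "fps_X ^ n dvd (psi oo fps_X ^ 2) - even_prod n * (plus_prod n oo fps_X ^ 2) ^ 2"
proof -
  have "psi - even_prod n * plus_prod n
      = plus_prod n * (odd_prod n * psi - even_prod n) - psi * (odd_prod n * plus_prod n - 1)"
    by algebra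
  then have "fps_X ^ n dvd psi - even_prod n * plus_prod n"
    using psi_odd_prod[of n] odd_prod_plus_prod[of n] by (metis dvd_diff dvd_mult)
  then have "\<forall>m<n. fps_nth ((psi - even_prod n * plus_prod n) oo fps_X ^ 2) m = 0"
    unfolding X_power_dvd_iff by (simp add: nth_compose_X_power)
  then have "fps_X ^ n dvd (psi - even_prod n * plus_prod n) oo fps_X ^ 2"
    unfolding X_power_dvd_iff .
  moreover have "even_prod n oo fps_X ^ 2 = even_prod n * (plus_prod n oo fps_X ^ 2)"
    unfolding even_prod_def plus_prod_def
      fps_compose_prod_distrib[of "fps_X ^ 2 :: int fps", simplified] prod.distrib[symmetric]
  proof (rule prod.cong)
    fix j
    have *: "fps_X ^ m oo fps_X ^ 2 = (fps_X ^ (2 * m) :: int fps)" for m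
      by (simp add: fps_X_power_compose flip: power_mult)
    have "fps_X ^ (2 * (2 * j + 2)) = fps_X ^ (2 * j + 2) * (fps_X ^ (2 * j + 2) :: int fps)"
      by (simp only: mult_2 power_add)
    moreover have "1 - a * a = (1 - a) * (1 + a)" for a :: "int fps"
      by (simp add: algebra_simps)
    moreover have "2 * (j + 1) = 2 * j + 2" by simp
    ultimately show "1 - fps_X ^ (2 * j + 2) oo fps_X ^ 2
        = (1 - fps_X ^ (2 * j + 2)) * (1 + fps_X ^ (j + 1) oo fps_X ^ 2 :: int fps)"
      by (simp only: fps_compose_sub_distrib fps_compose_add_distrib fps_compose_1 *)
  qed simp
  ultimately show ?thesis
    by (simp add: fps_compose_sub_distrib compose_X_power_mult
        power2_eq_square[of "plus_prod n oo _"] mult.assoc)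
qed

subsection \<open>The generating function of cubic partitions\<close>

definition cubic_parts :: "(nat \<times> bool) set" where
  "cubic_parts = {(k, c). k > 0 \<and> (odd k \<longrightarrow> c = False)}"

text \<open>
  The sign includes the parity of the weight, i.e. the series is taken at \<open>-q\<close>. This does not
  affect divisibility by 3 and makes all theta series below unsigned.
\<close>

definition signed_count :: "(nat \<times> bool) set \<Rightarrow> int fps" where
  "signed_count S = Abs_fps (\<lambda>n. \<Sum>P | set_mset P \<subseteq> S \<and> (\<Sum>(k, c) \<in># P. k) = n. (-1) ^ (size P + n))"

lemma finite_bounded_support:
  assumes "S \<subseteq> cubic_parts"
  shows "finite {P. set_mset P \<subseteq> S \<and> (\<Sum>(k, c) \<in># P. k) = n}"
  using assms
  by (intro finite_subset[OF _ finite_cubic_partitions[of n]])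
    (force simp: cubic_partitions_def cubic_parts_def)

lemma signed_count_empty: "signed_count {} = 1"
proof (rule fps_ext)
  fix n :: nat
  have "{P :: (nat \<times> bool) multiset. set_mset P \<subseteq> {} \<and> (\<Sum>(k, c) \<in># P. k) = n} = (if n = 0 then {{#}} else {})" by auto
  then have "fps_nth (signed_count {}) n = (\<Sum>P\<in>(if n = 0 then {{#}} else {} :: (nat \<times> bool) multiset set). (-1) ^ (size P + n))"
    unfolding signed_count_def by (simp only: fps_nth_Abs_fps)
  then show "fps_nth (signed_count {}) n = fps_nth 1 n" by simp
qed

text \<open>Multisets are split by whether they contain the new part. Removing one copy of it lowers
  the size by 1 and the weight by \<open>k\<close>, so the sign changes by
  \<open>- (-1) ^ k\<close>.\<close>

lemma signed_count_insert:
  assumes "insert (k, c) S \<subseteq> cubic_parts" "(k, c) \<notin> S"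
  shows "signed_count (insert (k, c) S) * (1 + (- fps_X) ^ k) = signed_count S"
proof (rule fps_ext)
  fix n
  define M where "M S n = {P. set_mset P \<subseteq> S \<and> (\<Sum>(k, c) \<in># P. k) = n}"
    for S :: "(nat \<times> bool) set" and n
  let ?S = "insert (k, c) S"
  let ?w = "\<lambda>n P. (-1) ^ (size P + n) :: int"
  have fin: "finite (M ?S m)" "finite (M S m)" for m
    using finite_bounded_support[of ?S] finite_bounded_support[of S] assms unfolding M_def by auto
  have nth: "fps_nth (signed_count S) n = sum (?w n) (M S n)" for S n
    by (simp add: signed_count_def M_def)
  have split: "M ?S n = M S n \<union> add_mset (k, c) ` (if n < k then {} else M ?S (n - k))"
  proof (intro set_eqI iffI)
    fix P assume P: "P \<in> M ?S n"
    show "P \<in> M S n \<union> add_mset (k, c) ` (if n < k then {} else M ?S (n - k))"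
    proof (cases "(k, c) \<in># P")
      case True
      then obtain Q where "P = add_mset (k, c) Q" by (meson mset_add)
      then show ?thesis using P by (auto simp: M_def)
    next
      case False
      then show ?thesis using P by (auto simp: M_def)
    qed
  qed (auto simp: M_def split: if_splits)
  have "(k, c) \<notin># P" if "P \<in> M S n" for P
    using that assms(2) by (auto simp: M_def)
  then have disj: "M S n \<inter> add_mset (k, c) ` (if n < k then {} else M ?S (n - k)) = {}"
    by (metis (no_types, lifting) disjoint_iff image_iff union_single_eq_member)
  have "sum (?w n) (M ?S n) = sum (?w n) (M S n)
      + sum (?w n) (add_mset (k, c) ` (if n < k then {} else M ?S (n - k)))"
    unfolding split by (rule sum.union_disjoint) (simp_all only: disj, simp_all add: fin)
  also have "sum (?w n) (add_mset (k, c) ` (if n < k then {} else M ?S (n - k)))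
      = (if n < k then 0 else - ((-1) ^ k * sum (?w (n - k)) (M ?S (n - k))))"
  proof (cases "n < k")
    case False
    then have "sum (?w n) (add_mset (k, c) ` M ?S (n - k)) = (\<Sum>P\<in>M ?S (n - k). (-1) ^ (size P + 1 + (n - k + k)))"
      by (subst sum.reindex) (auto simp: inj_on_def)
    also have "\<dots> = - ((-1) ^ k * sum (?w (n - k)) (M ?S (n - k)))"
      by (simp add: sum_distrib_left power_add mult_ac flip: sum_negf)
    finally show ?thesis using False by simp
  qed simp
  finally have "sum (?w n) (M S n)
      = sum (?w n) (M ?S n) + (if n < k then 0 else (-1) ^ k * sum (?w (n - k)) (M ?S (n - k)))"
    by simp
  moreover have "(- fps_X) ^ k = fps_const ((-1) ^ k) * (fps_X ^ k :: int fps)"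
  proof -
    have "(- fps_X :: int fps) = fps_const (-1) * fps_X" by (simp add: fps_eq_iff)
    then show ?thesis by (simp only: power_mult_distrib fps_const_power)
  qed
  then have "signed_count ?S * (1 + (- fps_X) ^ k)
      = signed_count ?S + fps_const ((-1) ^ k) * (fps_X ^ k * signed_count ?S)"
    by (simp add: algebra_simps)
  ultimately show "fps_nth (signed_count ?S * (1 + (- fps_X) ^ k)) n = fps_nth (signed_count S) n"
    by (simp add: nth fps_X_power_mult_nth)
qed

text \<open>At \<open>-q\<close>, each odd part contributes \<open>1 - q^k\<close> to the
  denominator and each even part \<open>1 + q^k\<close>, squared because of its two colours.\<close>

lemma signed_count_prod:
  "signed_count {(k, c) \<in> cubic_parts. k \<le> 2 * n} * (odd_prod n * (plus_prod n oo fps_X ^ 2) ^ 2) = 1"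
proof (induction n)
  case 0
  have "{(k, c) \<in> cubic_parts. k \<le> 2 * 0} = {}" by (auto simp: cubic_parts_def)
  then show ?case unfolding \<open>_ = {}\<close> by (simp add: signed_count_empty odd_prod_def plus_prod_def)
next
  case (Suc n)
  define S where "S m = {(k, c) \<in> cubic_parts. k \<le> 2 * m}" for m
  let ?a = "2 * n + 1" and ?b = "2 * n + 2"
  have S: "S (Suc n) = insert (?b, True) (insert (?b, False) (insert (?a, False) (S n)))"
  proof (intro set_eqI iffI)
    fix p assume "p \<in> S (Suc n)"
    then obtain k c where "p = (k, c)" "k \<le> 2 * n \<or> k = ?a \<or> k = ?b" "(k, c) \<in> cubic_parts"
      unfolding S_def by fastforce
    then show "p \<in> insert (?b, True) (insert (?b, False) (insert (?a, False) (S n)))"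
      by (cases c) (auto simp: S_def cubic_parts_def)
  qed (auto simp: S_def cubic_parts_def)
  have "signed_count (S (Suc n)) * (1 + (- fps_X) ^ ?b) * (1 + (- fps_X) ^ ?b) * (1 + (- fps_X) ^ ?a)
      = signed_count (S n)"
    unfolding S
    by (subst signed_count_insert, force simp: S_def cubic_parts_def, force simp: S_def)+ simp
  moreover have "(- fps_X) ^ ?b = (fps_X ^ ?b :: int fps)" "(- fps_X) ^ ?a = - (fps_X ^ ?a :: int fps)"
    by simp_all
  moreover have "odd_prod (Suc n) = odd_prod n * (1 - fps_X ^ ?a)"
    by (simp add: odd_prod_def)
  moreover have "plus_prod (Suc n) oo fps_X ^ 2 = (plus_prod n oo fps_X ^ 2) * (1 + fps_X ^ ?b)"
  proof -
    have "fps_X ^ (n + 1) oo fps_X ^ 2 = (fps_X ^ ?b :: int fps)"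
      by (simp add: fps_X_power_compose del: power_Suc flip: power_mult)
    then show ?thesis
      by (simp add: plus_prod_def compose_X_power_mult fps_compose_add_distrib del: power_Suc)
  qed
  moreover have "signed_count (S n) * (odd_prod n * (plus_prod n oo fps_X ^ 2) ^ 2) = 1"
    using Suc.IH unfolding S_def .
  moreover have "w * (o' * (1 - a) * (r * (1 + b)) ^ 2) = w * (1 + b) * (1 + b) * (1 + - a) * (o' * r ^ 2)"
    for w o' a b r :: "int fps"
    by (simp add: algebra_simps power2_eq_square)
  ultimately have "signed_count (S (Suc n)) * (odd_prod (Suc n) * (plus_prod (Suc n) oo fps_X ^ 2) ^ 2) = 1"
    by (simp only:)
  then show ?case unfolding S_def .
qed

lemma A_eq_sum: "A n = (\<Sum>P\<in>cubic_partitions n. (-1) ^ size P)"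
proof -
  let ?E = "{P \<in> cubic_partitions n. even (size P)}" and ?Q = "{P \<in> cubic_partitions n. odd (size P)}"
  have "(\<Sum>P\<in>?E \<union> ?Q. (-1) ^ size P :: int) = (\<Sum>P\<in>?E. (-1) ^ size P) + (\<Sum>P\<in>?Q. (-1) ^ size P)"
    by (rule sum.union_disjoint) (use finite_cubic_partitions[of n] in auto)
  also have "?E \<union> ?Q = cubic_partitions n" by auto
  finally show ?thesis by (simp add: A_def)
qed

definition A_series :: "int fps" where "A_series = Abs_fps (\<lambda>n. (-1) ^ n * A n)"

text \<open>Coefficients below \<open>n\<close> see only parts below \<open>n\<close>, so the
  truncated counts suffice. Writing R for \<open>plus_prod\<close> at \<open>q^2\<close>,
  \<open>A_series\<close> is \<open>1 / (odd R^2)\<close>, \<open>psi(q^2)\<close> is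
  \<open>even R^2\<close>, and \<open>psi\<close> is \<open>even / odd\<close>.\<close>

lemma A_series_mult_psi: "A_series * (psi oo fps_X ^ 2) = psi"
proof -
  have "fps_X ^ n dvd A_series * (psi oo fps_X ^ 2) - psi" for n
  proof -
    define S where "S = {(k, c) \<in> cubic_parts. k \<le> 2 * n}"
    let ?R = "plus_prod n oo fps_X ^ 2"
    have part_le: "k \<le> (\<Sum>(k, c)\<in>#P. k)" if "(k, c) \<in># P" for P :: "(nat \<times> bool) multiset" and k c
      using that by (induction P) auto
    have "{P. set_mset P \<subseteq> S \<and> (\<Sum>(k, c) \<in># P. k) = m} = cubic_partitions m" if "m < n" for m
    proof (intro set_eqI iffI)
      fix P assume P: "P \<in> cubic_partitions m"
      then have "set_mset P \<subseteq> S"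
        using part_le[of _ _ P] that by (fastforce simp: S_def cubic_parts_def cubic_partitions_def)
      then show "P \<in> {P. set_mset P \<subseteq> S \<and> (\<Sum>(k, c) \<in># P. k) = m}"
        using P by (simp add: cubic_partitions_def)
    qed (force simp: S_def cubic_parts_def cubic_partitions_def)
    then have "fps_X ^ n dvd A_series - signed_count S"
      by (simp add: X_power_dvd_iff A_series_def signed_count_def A_eq_sum power_add sum_distrib_left mult.commute)
    then have "fps_X ^ n dvd (A_series - signed_count S) * (odd_prod n * ?R ^ 2)" by simp
    then have 1: "fps_X ^ n dvd A_series * (odd_prod n * ?R ^ 2) - 1"
      using signed_count_prod[of n] by (simp add: left_diff_distrib S_def)
    \<comment> \<open>The difference is expanded in the three truncation errors, so no division by a
      product is required.\<close>
    have "A_series * (psi oo fps_X ^ 2) - psi = A_series * ((psi oo fps_X ^ 2) - even_prod n * ?R ^ 2)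
        - A_series * ?R ^ 2 * (odd_prod n * psi - even_prod n) + psi * (A_series * (odd_prod n * ?R ^ 2) - 1)"
      by algebra
    moreover have "fps_X ^ n dvd A_series * ((psi oo fps_X ^ 2) - even_prod n * ?R ^ 2)
        - A_series * ?R ^ 2 * (odd_prod n * psi - even_prod n) + psi * (A_series * (odd_prod n * ?R ^ 2) - 1)"
      by (intro dvd_add dvd_diff dvd_mult 1 psi_odd_prod psi_square_prod)
    ultimately show ?thesis by simp
  qed
  then have "fps_nth (A_series * (psi oo fps_X ^ 2) - psi) m = 0" for m
    unfolding X_power_dvd_iff by blast
  then show ?thesis by (simp add: fps_eq_iff)
qed

subsection \<open>Trisection modulo 3\<close>

definition section3 :: "nat \<Rightarrow> 'a fps \<Rightarrow> 'a fps" where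
  "section3 r f = Abs_fps (\<lambda>n. fps_nth f (3 * n + r))"

lemma section3_nth: "fps_nth (section3 r f) n = fps_nth f (3 * n + r)"
  by (simp add: section3_def)

lemma section3_trisection:
  fixes a b c :: "'a::comm_ring_1 fps"
  defines "f \<equiv> (a oo fps_X ^ 3) + fps_X * (b oo fps_X ^ 3) + fps_X ^ 2 * (c oo fps_X ^ 3)"
  shows "section3 0 f = a" "section3 1 f = b" "section3 2 f = c"
proof -
  have "\<not> 3 dvd Suc (3 * n)" "\<not> 3 dvd Suc (Suc (3 * n))" "3 dvd 3 * n - Suc 0 \<longleftrightarrow> n = 0"
    "3 * n > 0 \<Longrightarrow> \<not> 3 dvd 3 * n - 2" "n > 0 \<Longrightarrow> \<not> 3 dvd Suc (3 * n) - 2" for n :: nat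
    by presburger+
  then show "section3 0 f = a" "section3 1 f = b" "section3 2 f = c"
    unfolding f_def
    by (auto simp: fps_eq_iff section3_nth nth_compose_X_power fps_X_power_mult_nth)
qed

lemma trisection:
  fixes f :: "'a::comm_ring_1 fps"
  shows "f = (section3 0 f oo fps_X ^ 3) + fps_X * (section3 1 f oo fps_X ^ 3)
    + fps_X ^ 2 * (section3 2 f oo fps_X ^ 3)" (is "f = ?g")
proof (rule fps_ext)
  fix n :: nat
  have "n = 3 * (n div 3) + 0 \<or> n = 3 * (n div 3) + 1 \<or> n = 3 * (n div 3) + 2" by presburger
  moreover have "fps_nth f (3 * m + r) = fps_nth ?g (3 * m + r)" if "r \<in> {0, 1, 2}" for m r
    using that section3_trisection[of "section3 0 f" "section3 1 f" "section3 2 f"]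
    by (auto simp only: section3_nth[symmetric])
  ultimately show "fps_nth f n = fps_nth ?g n" by (metis insertCI)
qed

text \<open>A factor that is a series in \<open>q^3\<close> shifts exponents by multiples of 3 only,
  hence passes through the extraction of a residue class.\<close>

lemma section3_mult:
  fixes f g :: "'a::idom fps"
  assumes "r < 3"
  shows "section3 r (f * (g oo fps_X ^ 3)) = section3 r f * g"
proof -
  have "f * (g oo fps_X ^ 3) = (section3 0 f * g oo fps_X ^ 3) + fps_X * (section3 1 f * g oo fps_X ^ 3)
      + fps_X ^ 2 * (section3 2 f * g oo fps_X ^ 3)"
    by (subst trisection[of f]) (simp add: compose_X_power_mult algebra_simps)
  moreover have "r = 0 \<or> r = 1 \<or> r = 2" using assms by auto
  ultimately show ?thesis by (auto simp only: section3_trisection)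
qed

lemma section3_diff:
  fixes f g :: "'a::ab_group_add fps"
  shows "section3 r (f - g) = section3 r f - section3 r g"
  by (simp add: section3_def fps_eq_iff)

lemma three_dvd_section3: "3 dvd f \<Longrightarrow> 3 dvd section3 r f" for f :: "int fps"
  unfolding numeral_dvd_fps_iff section3_nth by blast

text \<open>Multiplication by \<open>psi2 ^ 2\<close> turns the factor \<open>psi2\<close> beside
  \<open>A_series\<close> into a cube, which modulo 3 is a series in \<open>q^3\<close> and passes
  through \<open>section3 2\<close>. The theta identities then evaluate the remaining
  section.\<close>

lemma A_series_section: "3 dvd section3 2 A_series + (psi oo fps_X ^ 2) * (psi oo fps_X ^ 3)"
proof -
  define psi2 where "psi2 = psi oo fps_X ^ 2"
  define psi3 where "psi3 = psi oo fps_X ^ 3"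
  define psi6 where "psi6 = psi oo fps_X ^ 6"
  define P2 where "P2 = pentagonal oo fps_X ^ 2"
  note [simp] = compose_X_power_mult compose_X_power_X_power fps_compose_add_distrib
  have psi: "psi = (pentagonal oo fps_X ^ 3) + fps_X * (psi3 oo fps_X ^ 3)"
    unfolding psi3_def using psi_dissection by simp
  have "psi2 = ((pentagonal oo fps_X ^ 3) + fps_X * (psi oo fps_X ^ 9)) oo fps_X ^ 2"
    unfolding psi2_def using psi_dissection by simp
  then have psi2: "psi2 = (P2 oo fps_X ^ 3) + fps_X ^ 2 * (psi6 oo fps_X ^ 3)"
    unfolding P2_def psi6_def by simp
  have psi2_3: "psi2 oo fps_X ^ 3 = psi6"
    by (simp add: psi2_def psi6_def)
  obtain k where k: "psi2 ^ 3 = psi6 + 3 * k"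
    using three_dvd_cube_diff[of psi2] unfolding psi2_3 by (auto elim!: dvdE simp: algebra_simps)
  obtain l where l: "psi ^ 3 = psi3 + 3 * l"
    using three_dvd_cube_diff[of psi] by (auto elim!: dvdE simp: algebra_simps psi3_def)

  define U where "U = pentagonal * P2"
  define V where "V = fps_X * psi3 * psi6"
  have UV: "U + 2 * V = psi * phi"
    using psi_phi_lattice unfolding U_def V_def P2_def psi3_def psi6_def .
  \<comment> \<open>Modulo 3, \<open>psi\<close> has exponents 0 and 1, and \<open>psi2\<close> has
    0 and 2. Class 2 thus arises from \<open>2 a c d q^2\<close> and from \<open>b d^2 q^5\<close>,
    whose extra \<open>q^3\<close> is the factor \<open>fps_X\<close> in \<open>V\<close>.\<close>
  have "psi * psi2 ^ 2 = (pentagonal * P2 ^ 2 + (V * P2 + V * P2) oo fps_X ^ 3)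
      + fps_X * (psi3 * P2 ^ 2 + fps_X * pentagonal * psi6 ^ 2 oo fps_X ^ 3)
      + fps_X ^ 2 * (psi6 * (U + U + V) oo fps_X ^ 3)"
  proof -
    define a b c d where "a = pentagonal oo fps_X ^ 3" and "b = psi3 oo fps_X ^ 3"
      and "c = P2 oo fps_X ^ 3" and "d = psi6 oo fps_X ^ 3"
    have "psi * psi2 ^ 2 = (a + fps_X * b) * (c + fps_X ^ 2 * d) ^ 2"
      unfolding a_def b_def c_def d_def psi[symmetric] psi2[symmetric] ..
    also have "\<dots> = (a * c ^ 2 + (fps_X ^ 3 * b * d * c + fps_X ^ 3 * b * d * c))
      + fps_X * (b * c ^ 2 + fps_X ^ 3 * a * d ^ 2)
      + fps_X ^ 2 * (d * (a * c + a * c + fps_X ^ 3 * b * d))"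
      by (simp add: algebra_simps power2_eq_square power3_eq_cube)
    finally show ?thesis
      unfolding U_def V_def a_def b_def c_def d_def by (simp add: power2_eq_square)
  qed
  then have sec: "section3 2 (psi * psi2 ^ 2) = psi6 * (U + U + V)"
    by (simp only: section3_trisection)
  have "A_series * psi2 ^ 3 = psi * psi2 ^ 2"
    unfolding A_series_mult_psi[folded psi2_def, symmetric]
    by (simp add: power2_eq_square power3_eq_cube mult_ac)
  then have "A_series * (psi2 oo fps_X ^ 3) - psi * psi2 ^ 2 = 3 * (- (A_series * k))"
    unfolding psi2_3 k by (simp add: algebra_simps)
  then have "3 dvd A_series * (psi2 oo fps_X ^ 3) - psi * psi2 ^ 2" ..
  then have "3 dvd section3 2 A_series * psi2 - psi6 * (U + U + V)"
    using three_dvd_section3[of "A_series * (psi2 oo fps_X ^ 3) - psi * psi2 ^ 2" 2] 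
    by (simp add: section3_diff section3_mult sec)
  then obtain m where m: "section3 2 A_series * psi2 = psi6 * (U + U + V) + 3 * m"
    by (auto elim!: dvdE simp: algebra_simps)
  have sq: "psi ^ 2 = psi2 * phi" using psi_squared unfolding psi2_def .
  have "psi2 * (section3 2 A_series + psi2 * psi3) = 3 * (m + psi6 * (U + V) + k * psi * phi - psi2 ^ 2 * l)"
  \<comment> \<open>Modulo 3, \<open>psi2 ^ 2 * psi ^ 3\<close> is \<open>psi2 ^ 2 * psi3\<close> by
    the cube congruence and \<open>psi6 * (U + 2 * V)\<close> by the theta identities. Added to
    \<open>psi6 * (U + U + V)\<close>, it gives a multiple of 3.\<close>
  proof -
    have "psi2 ^ 2 * psi ^ 3 = psi2 ^ 2 * psi * psi ^ 2"
      by (simp add: power2_eq_square power3_eq_cube mult_ac)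
    also have "\<dots> = psi2 ^ 3 * (psi * phi)"
      unfolding sq by (simp add: power2_eq_square power3_eq_cube mult_ac)
    finally have "psi2 ^ 2 * (psi3 + 3 * l) = psi6 * (U + 2 * V) + 3 * k * (psi * phi)"
      unfolding k l UV by (simp add: algebra_simps)
    then have *: "psi2 ^ 2 * psi3 = psi6 * (U + 2 * V) + 3 * k * (psi * phi) - 3 * (psi2 ^ 2 * l)"
      by (simp add: algebra_simps)
    have "psi2 * (section3 2 A_series + psi2 * psi3) = section3 2 A_series * psi2 + psi2 ^ 2 * psi3"
      by (simp add: algebra_simps power2_eq_square)
    then show ?thesis unfolding m * by (simp add: algebra_simps)
  qed
  then have "3 dvd psi2 * (section3 2 A_series + psi2 * psi3)" by simp
  \<comment> \<open>A constant term 1 makes \<open>psi2\<close> a unit, so it cancels from the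
    divisibility.\<close>
  moreover have "fps_nth psi2 0 = 1"
    by (simp add: psi2_def psi_nth_0)
  ultimately show ?thesis
    unfolding psi2_def psi3_def by (blast intro: dvd_mult_unit_cancel fps_dvd_one)
qed


section \<open>Congruences for \<open>A\<close>\<close>

lemma A_dvd_iff: "3 dvd A n \<longleftrightarrow> 3 dvd fps_nth A_series n"
  by (cases "even n") (simp_all add: A_series_def)

lemma three_dvd_A_9n_plus_5: "3 dvd A (9 * n + 5)"
  and A_27n_plus_17: "3 dvd A (27 * n + 17) \<longleftrightarrow> 3 dvd A (3 * n + 2)"
proof -
  define psi2 where "psi2 = psi oo fps_X ^ 2"
  define psi3 where "psi3 = psi oo fps_X ^ 3"
  define psi6 where "psi6 = psi oo fps_X ^ 6"
  define P2 where "P2 = pentagonal oo fps_X ^ 2"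
  note [simp] = compose_X_power_mult compose_X_power_X_power fps_compose_add_distrib
  have "psi2 = ((pentagonal oo fps_X ^ 3) + fps_X * (psi oo fps_X ^ 9)) oo fps_X ^ 2"
    unfolding psi2_def using psi_dissection by simp
  \<comment> \<open>The zero middle term records that \<open>psi2\<close> has no exponents congruent
    to 1 mod 3.\<close>
  then have "psi2 = (P2 oo fps_X ^ 3) + fps_X * (0 oo fps_X ^ 3) + fps_X ^ 2 * (psi6 oo fps_X ^ 3)"
    unfolding P2_def psi6_def by simp
  then have psi2: "section3 1 psi2 = 0" "section3 2 psi2 = psi6"
    by (simp_all only: section3_trisection)
  have psi_eq: "psi = (pentagonal oo fps_X ^ 3) + fps_X * (psi3 oo fps_X ^ 3) + fps_X ^ 2 * (0 oo fps_X ^ 3)"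
    unfolding psi3_def using psi_dissection by simp
  have psi: "section3 1 psi = psi3"
    by (rule section3_trisection(2)[of pentagonal psi3 0, folded psi_eq])
  have psi6: "psi2 oo fps_X ^ 3 = psi6"
    by (simp add: psi2_def psi6_def)
  define g where "g = section3 2 A_series + psi2 * psi3"
  have g: "3 dvd g"
    using A_series_section unfolding g_def psi2_def psi3_def .
  have section_eq: "section3 2 A_series = g - psi2 * psi3"
    by (simp add: g_def)
  have "section3 1 (section3 2 A_series) = section3 1 g"
    unfolding section_eq section3_diff psi3_def by (simp add: section3_mult psi2 del: One_nat_def)
  then have "3 dvd section3 1 (section3 2 A_series)"
    using g three_dvd_section3 by simp
  then have "3 dvd fps_nth (section3 1 (section3 2 A_series)) n"
    using numeral_dvd_fps_iff by blast
  then show "3 dvd A (9 * n + 5)"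
    by (simp add: A_dvd_iff section3_nth algebra_simps)
  have "section3 2 (section3 2 A_series) = section3 2 g - psi * psi6"
    unfolding section_eq section3_diff psi3_def by (simp add: section3_mult psi2 mult.commute)
  then have "section3 1 (section3 2 (section3 2 A_series)) - section3 2 A_series = section3 1 (section3 2 g) - g"
    unfolding section_eq psi6[symmetric] by (simp add: section3_diff section3_mult psi mult.commute del: One_nat_def)
  then have "3 dvd section3 1 (section3 2 (section3 2 A_series)) - section3 2 A_series"
    using g three_dvd_section3 by (metis dvd_diff)
  then have "3 dvd fps_nth (section3 1 (section3 2 (section3 2 A_series)) - section3 2 A_series) n"
    using numeral_dvd_fps_iff by blast
  then have "3 dvd fps_nth A_series (27 * n + 17) - fps_nth A_series (3 * n + 2)"
    by (simp add: section3_nth algebra_simps)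
  then show "3 dvd A (27 * n + 17) \<longleftrightarrow> 3 dvd A (3 * n + 2)"
    unfolding A_dvd_iff using dvd_add_right_iff[of 3 "fps_nth A_series (27 * n + 17) - fps_nth A_series (3 * n + 2)" "fps_nth A_series (3 * n + 2)"]
    by simp
qed

theorem theorem3p2:
  fixes j n :: nat
  shows "[A (9 ^ (j + 1) * n + (39 * 9 ^ j + 1) div 8) = 0] (mod 3)"
proof -
  have "3 dvd A (9 ^ (j + 1) * n + (39 * 9 ^ j + 1) div 8)"
  proof (induction j)
    case 0
    show ?case using three_dvd_A_9n_plus_5[of n] by simp
  next
    case (Suc j)
    define N where "N = 9 ^ (j + 1) * n + (39 * 9 ^ j + 1) div 8"
    have N: "8 * N = 8 * (9 ^ (j + 1) * n) + 39 * 9 ^ j + 1"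
      using offset_exact[of j] by (simp add: N_def add_mult_distrib2)
    have "8 * (9 ^ (Suc j + 1) * n + (39 * 9 ^ Suc j + 1) div 8) = 8 * (9 ^ (Suc j + 1) * n) + 39 * 9 ^ Suc j + 1"
      using offset_exact[of "Suc j"] by (simp only: add_mult_distrib2 dvd_mult_div_cancel)
    \<comment> \<open>The next argument is \<open>9 * N - 1\<close>, written additively to avoid
      truncated subtraction.\<close>
    then have eq: "9 ^ (Suc j + 1) * n + (39 * 9 ^ Suc j + 1) div 8 + 1 = 9 * N"
      using N by simp
    \<comment> \<open>As 8 is -1 mod 3, \<open>N\<close> is 2 mod 3; for
      \<open>N = 3 * m + 2\<close> the next argument \<open>9 * N - 1\<close> is
      \<open>27 * m + 17\<close>.\<close>
    have "8 * N = 3 * (24 * (9 ^ j * n) + 13 * 9 ^ j) + 1"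
      using N by simp
    then obtain t where "8 * N = 3 * t + 1" ..
    then have "N mod 3 = 2" by presburger
    then obtain m where m: "N = 3 * m + 2"
      by (metis mult_div_mod_eq)
    have "9 ^ (Suc j + 1) * n + (39 * 9 ^ Suc j + 1) div 8 = 27 * m + 17"
      using eq m by simp
    then show ?case
      using A_27n_plus_17[of m] Suc.IH m by (simp add: N_def)
  qed
  then show ?thesis by (simp add: cong_0_iff)
qed

end
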